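(* Let $(X,f_{1,\infty})$ be a non-autonomous discrete system with $f_{1,\infty}$ feeble open and surjective and converging uniformly to a map $f$, and suppose that $\{f_n^{n+k}\}_{k\in\mathbb{N}}$ converges collectively to $\{f^k\}_{k\in\mathbb{N}}$. If $(X,f_{1,\infty})$ is syndetically transitive and weakly mixing, then $(X,f_{1,\infty})$ is multi-transitive.
   Context: $\mathbb{N}=\{1,2,3,\dots\}$. A non-autonomous discrete system $(X,f_{1,\infty})$ consists of a compact metric space $(X,d)$ and a sequence $f_{1,\infty}=\{f_n\}_{n=1}^\infty$ of continuous maps $f_n:X\to X$. For $i,n\in\mathbb{N}$, $f_i^n:=f_{i+(n-1)}\circ\cdots\circ f_i$ (a composition of $n$ maps), and $f_i^0=id_X$. Uniform convergence of $f_{1,\infty}$ to $f:X\to X$ means $D(f_n,f)\to 0$, where $D(g,h)=\sup_{x\in X}d(g(x),h(x))$. "$\{f_n^{n+k}\}_{k\in\mathbb{N}}$ converges collectively to $\{f^k\}_{k\in\mathbb{N}}$" means: for every $\varepsilon>0$ there exists $r_0\in\mathbb{N}$ such that $D(f_r^k,f^k)<\varepsilon$ for all $r\ge r_0$ and all $k\in\mathbb{N}$, where $f_r^k=f_{r+k-1}\circ\cdots\circ f_r$ and $f^k$ is the $k$-fold composition of $f$. $f_{1,\infty}$ is surjective if every $f_i$ is surjective. It is feeble open if $\mathrm{int}(f_i(U))\neq\emptyset$ for every nonempty open $U\subseteq X$ and every $i\in\mathbb{N}$. A set $A\subseteq\mathbb{N}$ is syndetic if there is a positive integer $M$ with $\{i,i+1,\dots,i+M\}\cap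 A\neq\emptyset$ for every $i\in\mathbb{N}$. The system is syndetically transitive if for any two nonempty open subsets $U,V\subseteq X$ the set $\{n\in\mathbb{N}: f_1^n(U)\cap V\neq\emptyset\}$ is syndetic. It is weakly mixing if for any four nonempty open subsets $U_1,U_2,V_1,V_2\subseteq X$ there exists $n\in\mathbb{N}$ such that $f_1^n(U_1)\cap V_1\neq\emptyset$ and $f_1^n(U_2)\cap V_2\neq\emptyset$. It is multi-transitive if for every $m\in\mathbb{N}$ and every collection of nonempty open subsets $U_1,\dots,U_m,V_1,\dots,V_m$ of $X$ there exists $l\in\mathbb{N}$ such that $f_1^{jl}(U_j)\cap V_j\neq\emptyset$ for each $j\in\{1,\dots,m\}$. *)

theory Defs
  imports "HOL-Analysis.Analysis"
begin

text \<open>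
  The compact metric space is the carrier type \<open>'a\<close>, with \<open>UNIV\<close> compact. A sequence of maps
  is a function \<open>F :: nat \<Rightarrow> 'a \<Rightarrow> 'a\<close> of which only the values at indices \<open>\<ge> 1\<close> are meaningful:
  every condition below constrains \<open>F i\<close> for \<open>i \<ge> 1\<close> only, and the value at \<open>0\<close> is arbitrary.
\<close>

definition nonautonomous_system :: "(nat \<Rightarrow> 'a::metric_space \<Rightarrow> 'a) \<Rightarrow> bool" where
  "nonautonomous_system F \<longleftrightarrow>
     compact (UNIV :: 'a set) \<and> (\<forall>i\<ge>1. continuous_on UNIV (F i))"

text \<open>\<open>iter F i n\<close> is the composition \<open>F (i + n - 1) \<circ> \<dots> \<circ> F i\<close> of \<open>n\<close> maps.\<close>

primrec iter :: "(nat \<Rightarrow> 'a \<Rightarrow> 'a) \<Rightarrow> nat \<Rightarrow> nat \<Rightarrow> 'a \<Rightarrow> 'a" where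
  "iter F i 0 = id"
| "iter F i (Suc n) = F (i + n) \<circ> iter F i n"

text \<open>On a compact space the distances are bounded, so this supremum is a genuine one.\<close>

definition sup_dist :: "('a \<Rightarrow> 'a::metric_space) \<Rightarrow> ('a \<Rightarrow> 'a) \<Rightarrow> real" where
  "sup_dist g h = (SUP x. dist (g x) (h x))"

definition converges_uniformly :: "(nat \<Rightarrow> 'a::metric_space \<Rightarrow> 'a) \<Rightarrow> ('a \<Rightarrow> 'a) \<Rightarrow> bool" where
  "converges_uniformly F f \<longleftrightarrow> (\<lambda>n. sup_dist (F n) f) \<longlonglongrightarrow> 0"

definition converges_collectively :: "(nat \<Rightarrow> 'a::metric_space \<Rightarrow> 'a) \<Rightarrow> ('a \<Rightarrow> 'a) \<Rightarrow> bool" where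
  "converges_collectively F f \<longleftrightarrow>
     (\<forall>\<epsilon>>0. \<exists>r0\<ge>1. \<forall>r\<ge>r0. \<forall>k\<ge>1. sup_dist (iter F r k) (f ^^ k) < \<epsilon>)"

definition surjective_system :: "(nat \<Rightarrow> 'a \<Rightarrow> 'a) \<Rightarrow> bool" where
  "surjective_system F \<longleftrightarrow> (\<forall>i\<ge>1. surj (F i))"

definition feeble_open :: "(nat \<Rightarrow> 'a::topological_space \<Rightarrow> 'a) \<Rightarrow> bool" where
  "feeble_open F \<longleftrightarrow>
     (\<forall>i\<ge>1. \<forall>U. open U \<and> U \<noteq> {} \<longrightarrow> interior (F i ` U) \<noteq> {})"

definition syndetic :: "nat set \<Rightarrow> bool" where
  "syndetic A \<longleftrightarrow> (\<exists>M\<ge>1. \<forall>i\<ge>1. {i..i + M} \<inter> A \<noteq> {})"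

definition syndetically_transitive :: "(nat \<Rightarrow> 'a::topological_space \<Rightarrow> 'a) \<Rightarrow> bool" where
  "syndetically_transitive F \<longleftrightarrow>
     (\<forall>U V. open U \<and> U \<noteq> {} \<and> open V \<and> V \<noteq> {} \<longrightarrow>
        syndetic {n. n \<ge> 1 \<and> iter F 1 n ` U \<inter> V \<noteq> {}})"

definition weakly_mixing :: "(nat \<Rightarrow> 'a::topological_space \<Rightarrow> 'a) \<Rightarrow> bool" where
  "weakly_mixing F \<longleftrightarrow>
     (\<forall>U1 U2 V1 V2.
        open U1 \<and> U1 \<noteq> {} \<and> open U2 \<and> U2 \<noteq> {} \<and>
        open V1 \<and> V1 \<noteq> {} \<and> open V2 \<and> V2 \<noteq> {} \<longrightarrow>
        (\<exists>n\<ge>1. iter F 1 n ` U1 \<inter> V1 \<noteq> {} \<and> iter F 1 n ` U2 \<inter> V2 \<noteq> {}))"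

definition multi_transitive :: "(nat \<Rightarrow> 'a::topological_space \<Rightarrow> 'a) \<Rightarrow> bool" where
  "multi_transitive F \<longleftrightarrow>
     (\<forall>m\<ge>1. \<forall>U V :: nat \<Rightarrow> 'a set.
        (\<forall>j\<in>{1..m}. open (U j) \<and> U j \<noteq> {} \<and> open (V j) \<and> V j \<noteq> {}) \<longrightarrow>
        (\<exists>l\<ge>1. \<forall>j\<in>{1..m}. iter F 1 (j * l) ` U j \<inter> V j \<noteq> {}))"

end

theory Submission
  imports Defs
begin

text \<open>
  Collective convergence compares \<open>f\<^sub>1\<^sup>c\<^sup>+\<^sup>k = f\<^sub>c\<^sub>+\<^sub>1\<^sup>k \<circ> f\<^sub>1\<^sup>c\<close> with \<open>f\<^sup>k \<circ> f\<^sub>1\<^sup>c\<close>, uniformly in \<open>k\<close>, once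
  \<open>c\<close> is large. Surjectivity pulls a source set back along \<open>f\<^sub>1\<^sup>c\<close>, so \<open>f\<close> inherits weak mixing and
  syndetic transitivity; feeble openness pushes a source set forward, so shifted hitting time sets
  of \<open>f\<close> are contained in those of the system. For the single map \<open>f\<close>, weak mixing makes every
  finite intersection of hitting time sets contain another one. Applied to the translates of a
  hitting time set, this shows that all hitting time sets of \<open>f\<close> are thickly syndetic. Thickly
  syndetic sets are stable under shifts, under \<open>A \<mapsto> {l. j * l \<in> A}\<close> and under finite
  intersections, which gives the required common \<open>l\<close>.
\<close>

section \<open>Thickly syndetic sets\<close>

text \<open>Equivalently, for every \<open>L\<close> the starting points of blocks of
  \<open>L + 1\<close> consecutive members form a set with bounded gaps.\<close>

definition thickly_syndetic :: "nat set \<Rightarrow> bool" where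
  "thickly_syndetic A \<longleftrightarrow> (\<forall>L. \<exists>M. \<forall>i. \<exists>p\<in>{i..i+M}. {p..p+L} \<subseteq> A)"

lemma thickly_syndetic_UNIV: "thickly_syndetic UNIV"
  unfolding thickly_syndetic_def by force

lemma thickly_syndetic_mono: "thickly_syndetic A \<Longrightarrow> A \<subseteq> B \<Longrightarrow> thickly_syndetic B"
  unfolding thickly_syndetic_def by (meson order_trans)

text \<open>With \<open>M\<close> the gap bound for \<open>L\<close>-blocks of \<open>B\<close>,
  every block of \<open>A\<close> stretched by \<open>M\<close> has an \<open>L\<close>-block of
  \<open>B\<close> inside it. Plain syndeticity has no such closure.\<close>

lemma thickly_syndetic_Int:
  assumes "thickly_syndetic A" "thickly_syndetic B"
  shows "thickly_syndetic (A \<inter> B)"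
  unfolding thickly_syndetic_def
proof
  fix L
  obtain M where M: "\<And>i. \<exists>p\<in>{i..i+M}. {p..p+L} \<subseteq> B"
    using assms(2) unfolding thickly_syndetic_def by blast
  obtain M' where M': "\<And>i. \<exists>p\<in>{i..i+M'}. {p..p+(M+L)} \<subseteq> A"
    using assms(1) unfolding thickly_syndetic_def by blast
  have "\<exists>p\<in>{i..i+(M'+M)}. {p..p+L} \<subseteq> A \<inter> B" for i
  proof -
    obtain p where p: "p \<in> {i..i+M'}" "{p..p+(M+L)} \<subseteq> A" using M' by blast
    obtain q where q: "q \<in> {p..p+M}" "{q..q+L} \<subseteq> B" using M by blast
    have "{q..q+L} \<subseteq> {p..p+(M+L)}" using q(1) by auto
    with p(2) q(2) have "{q..q+L} \<subseteq> A \<inter> B" by blast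
    moreover have "q \<in> {i..i+(M'+M)}" using p(1) q(1) by auto
    ultimately show ?thesis by blast
  qed
  then show "\<exists>M. \<forall>i. \<exists>p\<in>{i..i+M}. {p..p+L} \<subseteq> A \<inter> B" by blast
qed

lemma thickly_syndetic_INT:
  assumes "finite J" "\<And>j. j \<in> J \<Longrightarrow> thickly_syndetic (A j)"
  shows "thickly_syndetic (\<Inter>j\<in>J. A j)"
  using assms by (induction J) (simp_all add: thickly_syndetic_UNIV thickly_syndetic_Int)

lemma thickly_syndetic_translate:
  assumes "thickly_syndetic A"
  shows "thickly_syndetic ((+) c ` A)"
  unfolding thickly_syndetic_def
proof
  fix L
  obtain M where M: "\<And>i. \<exists>p\<in>{i..i+M}. {p..p+L} \<subseteq> A"
    using assms unfolding thickly_syndetic_def by blast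
  have "\<exists>p\<in>{i..i+(c+M)}. {p..p+L} \<subseteq> (+) c ` A" for i
  proof -
    obtain p where p: "p \<in> {i..i+M}" "{p..p+L} \<subseteq> A" using M by blast
    have "{c+p..c+p+L} = (+) c ` {p..p+L}" by (simp add: add.assoc)
    then have "{c+p..c+p+L} \<subseteq> (+) c ` A" using p(2) by (simp only: image_mono)
    moreover have "c+p \<in> {i..i+(c+M)}" using p(1) by auto
    ultimately show ?thesis by blast
  qed
  then show "\<exists>M. \<forall>i. \<exists>p\<in>{i..i+M}. {p..p+L} \<subseteq> (+) c ` A" by blast
qed

text \<open>A long enough block of \<open>A\<close> starting at \<open>p\<close> contains
  \<open>L + 1\<close> consecutive multiples of \<open>j\<close>: the least multiple
  \<open>j * q\<close> with \<open>p \<le> j * q\<close> is at most \<open>p + j\<close>. The gap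
  bound \<open>M\<close> survives because \<open>M \<le> j * M\<close>.\<close>

lemma thickly_syndetic_vimage_mult:
  assumes "thickly_syndetic A" "j \<ge> 1"
  shows "thickly_syndetic {l. j * l \<in> A}"
  unfolding thickly_syndetic_def
proof
  fix L
  obtain M where M: "\<And>i. \<exists>p\<in>{i..i+M}. {p..p+(j+j*L)} \<subseteq> A"
    using assms(1) unfolding thickly_syndetic_def by blast
  have "\<exists>q\<in>{i..i+M}. {q..q+L} \<subseteq> {l. j * l \<in> A}" for i
  proof -
    obtain p where p: "p \<in> {j*i..j*i+M}" "{p..p+(j+j*L)} \<subseteq> A" using M by blast
    have "p \<le> j * i + M" using p(1) by simp
    also have "\<dots> \<le> j * (i + M)" using assms(2) by (simp add: distrib_left)
    finally have "p \<le> j * (i + M)" .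
    define q where "q = (LEAST q. p \<le> j * q)"
    have q: "p \<le> j * q" "q \<le> i + M"
      using \<open>p \<le> j * (i + M)\<close> unfolding q_def by (auto intro: LeastI Least_le)
    have "j * i \<le> p" using p(1) by simp
    then have "j * i \<le> j * q" using q(1) by (rule order_trans)
    then have "i \<le> q" using assms(2) by simp
    have "j * q \<le> p + j"
    proof (cases q)
      case (Suc r)
      then have "\<not> p \<le> j * r" unfolding q_def using not_less_Least by (metis lessI)
      with Suc show ?thesis by simp
    qed simp
    have "j * l \<in> A" if "l \<in> {q..q+L}" for l
    proof -
      have "j * q \<le> j * l" "j * l \<le> j * (q + L)" using that by simp_all
      then have "p \<le> j * l" "j * l \<le> p + (j + j*L)"
        using q(1) \<open>j * q \<le> p + j\<close> unfolding distrib_left by linarith+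
      then have "j * l \<in> {p..p+(j+j*L)}" by simp
      then show ?thesis using p(2) by blast
    qed
    then show ?thesis using \<open>i \<le> q\<close> q(2) by fastforce
  qed
  then show "\<exists>M. \<forall>i. \<exists>p\<in>{i..i+M}. {p..p+L} \<subseteq> {l. j * l \<in> A}" by blast
qed

section \<open>Hitting times of a single map\<close>

definition hitting_times :: "(nat \<Rightarrow> 'a \<Rightarrow> 'a) \<Rightarrow> 'a set \<Rightarrow> 'a set \<Rightarrow> nat set" where
  "hitting_times g U V = {n. g n ` U \<inter> V \<noteq> {}}"

lemma hitting_times_iff: "n \<in> hitting_times g U V \<longleftrightarrow> (\<exists>x\<in>U. g n x \<in> V)"
  unfolding hitting_times_def by auto

lemma continuous_on_funpow:
  assumes "continuous_on UNIV (f :: 'a::topological_space \<Rightarrow> 'a)"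
  shows "continuous_on UNIV (f ^^ n)"
proof (induction n)
  case (Suc n)
  then show ?case
    unfolding funpow.simps by (rule continuous_on_compose) (rule continuous_on_subset[OF assms], simp)
qed simp

lemma open_vimage_funpow:
  fixes f :: "'a::topological_space \<Rightarrow> 'a"
  shows "continuous_on UNIV f \<Longrightarrow> open V \<Longrightarrow> open ((f ^^ n) -` V)"
  using continuous_on_funpow open_vimage by blast

text \<open>Furstenberg's intersection lemma; it rests on \<open>f\<^sup>n\<close> commuting with \<open>f\<^sup>k\<close>.\<close>

lemma hitting_times_Int:
  fixes f :: "'a::topological_space \<Rightarrow> 'a"
  assumes cont: "continuous_on UNIV f"
    and op: "open U1" "open V1" "open U2" "open V2"
    and n: "n \<in> hitting_times ((^^) f) U1 U2" "n \<in> hitting_times ((^^) f) V1 V2"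
  obtains U V where "open U" "U \<noteq> {}" "open V" "V \<noteq> {}"
    "hitting_times ((^^) f) U V \<subseteq> hitting_times ((^^) f) U1 V1 \<inter> hitting_times ((^^) f) U2 V2"
proof
  let ?U = "U1 \<inter> (f ^^ n) -` U2" and ?V = "V1 \<inter> (f ^^ n) -` V2"
  show "open ?U" "open ?V" using op open_vimage_funpow[OF cont] by auto
  show "?U \<noteq> {}" "?V \<noteq> {}" using n unfolding hitting_times_iff by auto
  show "hitting_times ((^^) f) ?U ?V
      \<subseteq> hitting_times ((^^) f) U1 V1 \<inter> hitting_times ((^^) f) U2 V2"
  proof
    fix k assume "k \<in> hitting_times ((^^) f) ?U ?V"
    then obtain x where x: "x \<in> ?U" "(f ^^ k) x \<in> ?V" unfolding hitting_times_iff by blast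
    have "(f ^^ k) ((f ^^ n) x) = (f ^^ n) ((f ^^ k) x)"
      by (metis add.commute comp_apply funpow_add)
    with x show "k \<in> hitting_times ((^^) f) U1 V1 \<inter> hitting_times ((^^) f) U2 V2"
      by (auto simp: hitting_times_iff intro: bexI[of _ x] bexI[of _ "(f ^^ n) x"])
  qed
qed

text \<open>A block \<open>{n..n+L}\<close> of hitting times from \<open>U\<close> to
  \<open>V\<close> means that \<open>n\<close> is a hitting time from \<open>U\<close> to each
  preimage of \<open>V\<close> under \<open>f ^^ i\<close>, \<open>i \<le> L\<close>. The
  intersection lemma, used once per \<open>i\<close>, finds one pair \<open>U'\<close>,
  \<open>V'\<close> whose hitting times all have this property, and these have bounded gaps by
  \<open>synd\<close>.\<close>

lemma thickly_syndetic_hitting_times: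
  fixes f :: "'a::topological_space \<Rightarrow> 'a"
  assumes cont: "continuous_on UNIV f"
    and mixing: "\<And>U1 V1 U2 V2 :: 'a set.
      \<lbrakk>open U1; U1 \<noteq> {}; open V1; V1 \<noteq> {}; open U2; U2 \<noteq> {}; open V2; V2 \<noteq> {}\<rbrakk>
      \<Longrightarrow> hitting_times ((^^) f) U1 V1 \<inter> hitting_times ((^^) f) U2 V2 \<noteq> {}"
    and synd: "\<And>U V :: 'a set. \<lbrakk>open U; U \<noteq> {}; open V; V \<noteq> {}\<rbrakk>
      \<Longrightarrow> \<exists>M. \<forall>i. {i..i+M} \<inter> hitting_times ((^^) f) U V \<noteq> {}"
    and UV: "open U" "U \<noteq> {}" "open V" "V \<noteq> {}"
  shows "thickly_syndetic (hitting_times ((^^) f) U V)"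
proof -
  \<comment> \<open>Surjectivity of \<open>f\<close> is not assumed here. Bounded gaps supply a
    hitting time \<open>n \<ge> i\<close> instead, and the point reached after \<open>n - i\<close>
    steps lies in the preimage.\<close>
  have preimage: "(f ^^ i) -` V \<noteq> {}" for i
  proof -
    obtain M where "{i..i+M} \<inter> hitting_times ((^^) f) U V \<noteq> {}" using synd[OF UV] by blast
    then obtain n x where "i \<le> n" "(f ^^ n) x \<in> V" unfolding hitting_times_def by fastforce
    then have "(f ^^ i) ((f ^^ (n - i)) x) \<in> V"
      by (metis comp_apply funpow_add le_add_diff_inverse)
    then show ?thesis by blast
  qed
  have step: "\<exists>U' V'. open U' \<and> U' \<noteq> {} \<and> open V' \<and> V' \<noteq> {} \<and>
      (\<forall>n\<in>hitting_times ((^^) f) U' V'. {n..n+L} \<subseteq> hitting_times ((^^) f) U V)" for L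
  proof (induction L)
    case 0
    show ?case using UV by (intro exI[of _ U] exI[of _ V]) simp
  next
    case (Suc L)
    then obtain U' V' where *: "open U'" "U' \<noteq> {}" "open V'" "V' \<noteq> {}"
      "\<And>n. n \<in> hitting_times ((^^) f) U' V' \<Longrightarrow> {n..n+L} \<subseteq> hitting_times ((^^) f) U V"
      by blast
    let ?V = "(f ^^ Suc L) -` V"
    have "open ?V" using open_vimage_funpow[OF cont UV(3)] .
    \<comment> \<open>The intersection lemma needs a single time that joins the two sources
      \<open>U'\<close>, \<open>U\<close> and also the two targets \<open>V'\<close>,
      \<open>?V\<close>; weak mixing provides it.\<close>
    then obtain n where n: "n \<in> hitting_times ((^^) f) U' U" "n \<in> hitting_times ((^^) f) V' ?V"
      using mixing[OF *(1,2) UV(1,2) *(3,4)] preimage by blast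
    obtain A B where AB: "open A" "A \<noteq> {}" "open B" "B \<noteq> {}"
      "hitting_times ((^^) f) A B
        \<subseteq> hitting_times ((^^) f) U' V' \<inter> hitting_times ((^^) f) U ?V"
      using hitting_times_Int[OF cont *(1,3) UV(1) \<open>open ?V\<close> n] .
    have "{k..k + Suc L} \<subseteq> hitting_times ((^^) f) U V" if "k \<in> hitting_times ((^^) f) A B" for k
    proof -
      have "k \<in> hitting_times ((^^) f) U' V'" "k \<in> hitting_times ((^^) f) U ?V"
        using AB(5) that by auto
      then have "{k..k+L} \<subseteq> hitting_times ((^^) f) U V" "Suc L + k \<in> hitting_times ((^^) f) U V"
        using *(5) unfolding hitting_times_iff funpow_add by auto
      moreover have "{k..k + Suc L} = insert (Suc L + k) {k..k+L}" by auto
      ultimately show ?thesis by (simp only: insert_subset)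
    qed
    with AB(1-4) show ?case by blast
  qed
  show ?thesis
    unfolding thickly_syndetic_def
  proof
    fix L
    obtain U' V' where *: "open U'" "U' \<noteq> {}" "open V'" "V' \<noteq> {}"
      "\<And>n. n \<in> hitting_times ((^^) f) U' V' \<Longrightarrow> {n..n+L} \<subseteq> hitting_times ((^^) f) U V"
      using step[of L] by blast
    obtain M where "\<And>i. {i..i+M} \<inter> hitting_times ((^^) f) U' V' \<noteq> {}"
      using synd[OF *(1-4)] by blast
    with *(5) show "\<exists>M. \<forall>i. \<exists>p\<in>{i..i+M}. {p..p+L} \<subseteq> hitting_times ((^^) f) U V" by blast
  qed
qed

section \<open>Non-autonomous systems\<close>

lemma iter_add: "iter F i (c + k) = iter F (i + c) k \<circ> iter F i c"
  by (induction k) (auto simp: add.assoc)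

lemma continuous_on_iter:
  assumes "nonautonomous_system F" "i \<ge> 1"
  shows "continuous_on UNIV (iter F i n)"
proof (induction n)
  case (Suc n)
  have "continuous_on UNIV (F (i + n))"
    using assms unfolding nonautonomous_system_def by simp
  with Suc show ?case
    unfolding iter.simps by (intro continuous_on_compose) (auto intro: continuous_on_subset)
qed (simp add: id_def)

lemma surj_iter:
  assumes "surjective_system F" "i \<ge> 1"
  shows "surj (iter F i n)"
proof (induction n)
  case (Suc n)
  have "surj (F (i + n))" using assms unfolding surjective_system_def by simp
  with Suc show ?case unfolding iter.simps by (intro comp_surj)
qed simp

text \<open>Feeble openness applies to open sets only, so each step is applied to the interior of
  the previous image.\<close>

lemma interior_iter_image:
  assumes "feeble_open F" "i \<ge> 1" "open U" "U \<noteq> {}"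
  shows "interior (iter F i n ` U) \<noteq> {}"
proof (induction n)
  case 0
  then show ?case using assms by (simp add: interior_open)
next
  case (Suc n)
  let ?W = "interior (iter F i n ` U)"
  have "interior (F (i + n) ` ?W) \<noteq> {}"
    using assms(1,2) Suc unfolding feeble_open_def by simp
  moreover have "interior (F (i + n) ` ?W) \<subseteq> interior (iter F i (Suc n) ` U)"
    by (intro interior_mono) (auto simp: image_comp[symmetric] dest: subsetD[OF interior_subset])
  ultimately show ?case by blast
qed

lemma dist_le_sup_dist:
  assumes "compact (UNIV :: 'a::metric_space set)"
  shows "dist (g x) (h x) \<le> sup_dist g (h :: 'a \<Rightarrow> 'a)"
proof -
  obtain e where "\<And>x y :: 'a. dist x y \<le> e"
    using compact_imp_bounded[OF assms] unfolding bounded_two_points by auto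
  then show ?thesis
    unfolding sup_dist_def by (intro cSUP_upper bdd_aboveI2[of _ _ e]) auto
qed

lemma continuous_on_uniform_limit_map:
  fixes F :: "nat \<Rightarrow> 'a::metric_space \<Rightarrow> 'a"
  assumes "nonautonomous_system F" "converges_uniformly F f"
  shows "continuous_on UNIV f"
proof (rule uniform_limit_theorem)
  have comp: "compact (UNIV :: 'a set)" using assms(1) unfolding nonautonomous_system_def by simp
  show "\<forall>\<^sub>F n in sequentially. continuous_on UNIV (F n)"
    using assms(1) unfolding nonautonomous_system_def eventually_sequentially by blast
  show "uniform_limit UNIV F f sequentially"
  proof (rule uniform_limitI)
    fix e :: real assume "e > 0"
    then have "\<forall>\<^sub>F n in sequentially. sup_dist (F n) f < e"
      using assms(2) order_tendstoD(2) unfolding converges_uniformly_def by blast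
    then show "\<forall>\<^sub>F n in sequentially. \<forall>x\<in>UNIV. dist (F n x) (f x) < e"
      by eventually_elim (use dist_le_sup_dist[OF comp] in \<open>blast intro: le_less_trans\<close>)
  qed
qed simp

text \<open>The target set absorbs the collective approximation error by shrinking it first.\<close>

lemma collective_shrink:
  fixes F :: "nat \<Rightarrow> 'a::metric_space \<Rightarrow> 'a"
  assumes "compact (UNIV :: 'a set)" "converges_collectively F f" "open V" "V \<noteq> {}"
  obtains V' c0 where "open V'" "V' \<noteq> {}"
    "\<And>c k x. c \<ge> c0 \<Longrightarrow> (f ^^ k) x \<in> V' \<Longrightarrow> iter F (1 + c) k x \<in> V"
    "\<And>c k x. c \<ge> c0 \<Longrightarrow> iter F (1 + c) k x \<in> V' \<Longrightarrow> (f ^^ k) x \<in> V"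
proof -
  obtain z e where e: "e > 0" "ball z e \<subseteq> V" using assms(3,4) open_contains_ball by blast
  obtain r0 where r0: "\<And>r k. r \<ge> r0 \<Longrightarrow> k \<ge> 1 \<Longrightarrow> sup_dist (iter F r k) (f ^^ k) < e/2"
    using assms(2) e(1) unfolding converges_collectively_def by (meson half_gt_zero)
  \<comment> \<open>Collective convergence speaks of \<open>k \<ge> 1\<close> only; for
    \<open>k = 0\<close> both maps are the identity.\<close>
  have close: "dist (iter F (1 + c) k x) ((f ^^ k) x) < e/2" if "c \<ge> r0" for c k x
  proof (cases "k = 0")
    case False
    with that show ?thesis
      using r0[of "1 + c" k] dist_le_sup_dist[OF assms(1), of "iter F (1 + c) k" x "f ^^ k"] by simp
  qed (use e in simp)
  have enlarge: "b \<in> V" if "a \<in> ball z (e/2)" "dist a b < e/2" for a b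
    using that e(2) dist_triangle_less_add[of z a "e/2" b "e/2"] by (auto simp: dist_commute)
  show ?thesis
  proof (rule that)
    show "open (ball z (e/2))" "ball z (e/2) \<noteq> {}" using e(1) by auto
    show "iter F (1 + c) k x \<in> V" if "c \<ge> r0" "(f ^^ k) x \<in> ball z (e/2)" for c k x
      using enlarge[OF that(2)] close[OF that(1)] by (simp add: dist_commute)
    show "(f ^^ k) x \<in> V" if "c \<ge> r0" "iter F (1 + c) k x \<in> ball z (e/2)" for c k x
      using enlarge[OF that(2)] close[OF that(1)] by simp
  qed
qed

text \<open>Unless the space is a point, weak mixing excludes isolated points, so the sets can be shrunk
  until the first \<open>R\<close> iterates miss their target.\<close>

lemma weakly_mixing_late:
  fixes F :: "nat \<Rightarrow> 'a::metric_space \<Rightarrow> 'a"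
  assumes "nonautonomous_system F" "weakly_mixing F"
    and U1: "open U1" "U1 \<noteq> {}" and V1: "open V1" "V1 \<noteq> {}"
    and U2: "open U2" "U2 \<noteq> {}" and V2: "open V2" "V2 \<noteq> {}"
  shows "\<exists>n\<ge>R. n \<in> hitting_times (iter F 1) U1 V1 \<inter> hitting_times (iter F 1) U2 V2"
proof (cases "\<exists>x y :: 'a. x \<noteq> y")
  case False
  then have "A = UNIV" if "A \<noteq> {}" for A :: "'a set" using that by (metis UNIV_eq_I ex_in_conv)
  then have "U1 = UNIV" "V1 = UNIV" "U2 = UNIV" "V2 = UNIV" using U1 V1 U2 V2 by simp_all
  then show ?thesis by (auto simp: hitting_times_iff)
next
  case True
  have wm: "\<exists>n\<ge>1. iter F 1 n ` A \<inter> B \<noteq> {} \<and> iter F 1 n ` C \<inter> D \<noteq> {}"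
    if "open A" "A \<noteq> {}" "open B" "B \<noteq> {}" "open C" "C \<noteq> {}" "open D" "D \<noteq> {}" for A B C D
    using assms(2) that unfolding weakly_mixing_def by blast
  \<comment> \<open>At a common time the single point \<open>a\<close> would have to land in both of
    two disjoint open sets.\<close>
  have not_isolated: "\<not> open {a}" for a :: 'a
  proof
    assume "open {a}"
    obtain x y :: 'a where "x \<noteq> y" using True by blast
    then obtain A B where "open A" "open B" "x \<in> A" "y \<in> B" "A \<inter> B = {}"
      by (metis hausdorff)
    then show False
      using wm[OF \<open>open {a}\<close> _ \<open>open A\<close> _ \<open>open {a}\<close> _ \<open>open B\<close>] by auto
  qed
  have "\<exists>A B. open A \<and> A \<noteq> {} \<and> A \<subseteq> U1 \<and> open B \<and> B \<noteq> {} \<and> B \<subseteq> V1 \<and>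
      (\<forall>n<R. n \<notin> hitting_times (iter F 1) A B)"
  proof (induction R)
    case 0
    then show ?case using U1 V1 by blast
  next
    case (Suc R)
    then obtain A B where AB: "open A" "A \<noteq> {}" "A \<subseteq> U1" "open B" "B \<noteq> {}" "B \<subseteq> V1"
      "\<And>n. n < R \<Longrightarrow> n \<notin> hitting_times (iter F 1) A B" by blast
    obtain u where u: "u \<in> A" using AB(2) by blast
    \<comment> \<open>Since no point is isolated, \<open>B\<close> is not a singleton. Separating
      \<open>v\<close> from the time-\<open>R\<close> image of \<open>u\<close> removes
      \<open>R\<close> from the hitting times.\<close>
    obtain v where v: "v \<in> B" "iter F 1 R u \<noteq> v"
      using AB(4,5) not_isolated by (metis is_singletonI' is_singleton_the_elem)
    then obtain C D where CD: "open C" "open D" "iter F 1 R u \<in> C" "v \<in> D" "C \<inter> D = {}"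
      by (metis hausdorff)
    let ?A = "A \<inter> iter F 1 R -` C" and ?B = "B \<inter> D"
    have "open ?A"
      using AB(1) CD(1) continuous_on_iter[OF assms(1), of 1 R] open_vimage by blast
    moreover have "open ?B" using AB(4) CD(2) by blast
    moreover have "?A \<noteq> {}" "?B \<noteq> {}" using u v CD by auto
    moreover have "n \<notin> hitting_times (iter F 1) ?A ?B" if "n < Suc R" for n
    proof (cases "n = R")
      case True
      then show ?thesis using CD(5) unfolding hitting_times_iff by blast
    next
      case False
      then show ?thesis using that AB(7)[of n] unfolding hitting_times_iff by auto
    qed
    moreover have "?A \<subseteq> U1" "?B \<subseteq> V1" using AB(3,6) by auto
    ultimately show ?case by (intro exI[of _ ?A] exI[of _ ?B] conjI allI impI)
  qed
  then obtain A B where AB: "open A" "A \<noteq> {}" "A \<subseteq> U1" "open B" "B \<noteq> {}" "B \<subseteq> V1"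
    "\<And>n. n < R \<Longrightarrow> n \<notin> hitting_times (iter F 1) A B" by blast
  \<comment> \<open>Shrinking the first pair is enough, because the time is common to both
    pairs.\<close>
  obtain n where n: "iter F 1 n ` A \<inter> B \<noteq> {}" "iter F 1 n ` U2 \<inter> V2 \<noteq> {}"
    using wm[OF AB(1,2,4,5) U2 V2] by blast
  then have "n \<ge> R" using AB(7)[of n] unfolding hitting_times_def by force
  moreover have "iter F 1 n ` U1 \<inter> V1 \<noteq> {}" using n(1) AB(3,6) by blast
  ultimately show ?thesis using n(2) unfolding hitting_times_def by blast
qed

text \<open>If \<open>x\<close> starts in the pullback of \<open>U\<close> and reaches
  \<open>V'\<close> at time \<open>c + k\<close>, then its position at time \<open>c\<close> lies in
  \<open>U\<close> and is carried into \<open>V'\<close> by \<open>iter F (1 + c) k\<close>, which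
  is close to \<open>f ^^ k\<close>. Leaving \<open>c \<ge> c0\<close> free lets two pairs share one
  \<open>c\<close>.\<close>

lemma hitting_times_limit_map:
  fixes F :: "nat \<Rightarrow> 'a::metric_space \<Rightarrow> 'a"
  assumes sys: "nonautonomous_system F" "surjective_system F" "converges_collectively F f"
    and UV: "open U" "U \<noteq> {}" "open V" "V \<noteq> {}"
  obtains V' c0 where "open V'" "V' \<noteq> {}"
    "\<And>c. open (iter F 1 c -` U)" "\<And>c. iter F 1 c -` U \<noteq> {}"
    "\<And>c k. c \<ge> c0 \<Longrightarrow> c + k \<in> hitting_times (iter F 1) (iter F 1 c -` U) V'
      \<Longrightarrow> k \<in> hitting_times ((^^) f) U V"
proof -
  have comp: "compact (UNIV :: 'a set)" using sys(1) unfolding nonautonomous_system_def by simp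
  obtain V' c0 where V': "open V'" "V' \<noteq> {}"
    "\<And>c k x. c \<ge> c0 \<Longrightarrow> iter F (1 + c) k x \<in> V' \<Longrightarrow> (f ^^ k) x \<in> V"
    using collective_shrink[OF comp sys(3) UV(3,4)] by metis
  show ?thesis
  proof (rule that[OF V'(1,2)])
    show "open (iter F 1 c -` U)" for c
      using UV(1) continuous_on_iter[OF sys(1), of 1 c] open_vimage by blast
    show "iter F 1 c -` U \<noteq> {}" for c
      using UV(2) surj_iter[OF sys(2), of 1 c] by (metis le_refl surj_image_vimage_eq image_empty)
    show "k \<in> hitting_times ((^^) f) U V"
      if "c \<ge> c0" "c + k \<in> hitting_times (iter F 1) (iter F 1 c -` U) V'" for c k
      using that V'(3)[OF that(1), of k] unfolding hitting_times_iff iter_add by auto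
  qed
qed

lemma limit_map_weakly_mixing:
  fixes F :: "nat \<Rightarrow> 'a::metric_space \<Rightarrow> 'a"
  assumes sys: "nonautonomous_system F" "surjective_system F" "converges_collectively F f"
    and wm: "weakly_mixing F"
    and UV1: "open U1" "U1 \<noteq> {}" "open V1" "V1 \<noteq> {}"
    and UV2: "open U2" "U2 \<noteq> {}" "open V2" "V2 \<noteq> {}"
  shows "hitting_times ((^^) f) U1 V1 \<inter> hitting_times ((^^) f) U2 V2 \<noteq> {}"
proof -
  obtain W1 c1 where 1: "open W1" "W1 \<noteq> {}"
    "\<And>c. open (iter F 1 c -` U1)" "\<And>c. iter F 1 c -` U1 \<noteq> {}"
    "\<And>c k. c \<ge> c1 \<Longrightarrow> c + k \<in> hitting_times (iter F 1) (iter F 1 c -` U1) W1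
      \<Longrightarrow> k \<in> hitting_times ((^^) f) U1 V1"
    using hitting_times_limit_map[OF sys UV1] by metis
  obtain W2 c2 where 2: "open W2" "W2 \<noteq> {}"
    "\<And>c. open (iter F 1 c -` U2)" "\<And>c. iter F 1 c -` U2 \<noteq> {}"
    "\<And>c k. c \<ge> c2 \<Longrightarrow> c + k \<in> hitting_times (iter F 1) (iter F 1 c -` U2) W2
      \<Longrightarrow> k \<in> hitting_times ((^^) f) U2 V2"
    using hitting_times_limit_map[OF sys UV2] by metis
  \<comment> \<open>Both transfers must start from the same \<open>c\<close>, and the common time
    must be at least \<open>c\<close> to split as \<open>c + k\<close>.\<close>
  define c where "c = max c1 c2"
  obtain n where "n \<ge> c" and n: "n \<in> hitting_times (iter F 1) (iter F 1 c -` U1) W1"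
    "n \<in> hitting_times (iter F 1) (iter F 1 c -` U2) W2"
    using weakly_mixing_late[OF sys(1) wm 1(3,4,1,2) 2(3,4,1,2)] by blast
  then obtain k where "n = c + k" using le_iff_add by blast
  then show ?thesis using 1(5)[of c k] 2(5)[of c k] n unfolding c_def by auto
qed

lemma limit_map_syndetic:
  fixes F :: "nat \<Rightarrow> 'a::metric_space \<Rightarrow> 'a"
  assumes sys: "nonautonomous_system F" "surjective_system F" "converges_collectively F f"
    and st: "syndetically_transitive F"
    and UV: "open U" "U \<noteq> {}" "open V" "V \<noteq> {}"
  shows "\<exists>M. \<forall>i. {i..i+M} \<inter> hitting_times ((^^) f) U V \<noteq> {}"
proof -
  obtain W c where W: "open W" "W \<noteq> {}" "open (iter F 1 c -` U)" "iter F 1 c -` U \<noteq> {}"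
    "\<And>k. c + k \<in> hitting_times (iter F 1) (iter F 1 c -` U) W
      \<Longrightarrow> k \<in> hitting_times ((^^) f) U V"
    using hitting_times_limit_map[OF sys UV] by (metis order_refl)
  obtain M where M: "\<And>i. i \<ge> 1 \<Longrightarrow>
      {i..i+M} \<inter> {n. n \<ge> 1 \<and> iter F 1 n ` (iter F 1 c -` U) \<inter> W \<noteq> {}} \<noteq> {}"
    using st W(1-4) unfolding syndetically_transitive_def syndetic_def by meson
  \<comment> \<open>The window starts at \<open>Suc (c + i)\<close>, a positive index beyond
    \<open>c\<close>. Subtracting \<open>c\<close> leaves \<open>{Suc i..Suc i + M}\<close>, hence
    the bound \<open>M + 1\<close>.\<close>
  have "{i..i+(M+1)} \<inter> hitting_times ((^^) f) U V \<noteq> {}" for i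
  proof -
    obtain n where n: "n \<in> {Suc (c + i)..Suc (c + i) + M}"
      "n \<in> hitting_times (iter F 1) (iter F 1 c -` U) W"
      using M[of "Suc (c + i)"] unfolding hitting_times_def by fastforce
    then obtain k where k: "n = c + k" by (metis atLeastAtMost_iff le_iff_add Suc_leD add_leD1)
    then have "k \<in> {i..i+(M+1)}" using n(1) by auto
    then show ?thesis using W(5) n(2) k by blast
  qed
  then show ?thesis by blast
qed

theorem theorem13:
  fixes F :: "nat \<Rightarrow> 'a::metric_space \<Rightarrow> 'a" and f :: "'a \<Rightarrow> 'a"
  assumes "nonautonomous_system F"
    and "feeble_open F"
    and "surjective_system F"
    and "converges_uniformly F f"
    and "converges_collectively F f"
    and "syndetically_transitive F"
    and "weakly_mixing F"
  shows "multi_transitive F"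
  unfolding multi_transitive_def
proof (intro allI impI)
  fix m :: nat and U V :: "nat \<Rightarrow> 'a set"
  assume UV: "\<forall>j\<in>{1..m}. open (U j) \<and> U j \<noteq> {} \<and> open (V j) \<and> V j \<noteq> {}"
  have comp: "compact (UNIV :: 'a set)" using assms(1) unfolding nonautonomous_system_def by simp
  have thick: "thickly_syndetic (hitting_times ((^^) f) A B)"
    if "open A" "A \<noteq> {}" "open B" "B \<noteq> {}" for A B
    using continuous_on_uniform_limit_map[OF assms(1,4)]
      limit_map_weakly_mixing[OF assms(1,3,5,7)] limit_map_syndetic[OF assms(1,3,5,6)] that
    by (rule thickly_syndetic_hitting_times)
  have "thickly_syndetic {l. j * l \<in> hitting_times (iter F 1) (U j) (V j)}"
    if "j \<in> {1..m}" for j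
  proof -
    have UVj: "open (U j)" "U j \<noteq> {}" "open (V j)" "V j \<noteq> {}" using UV that by auto
    obtain W c where W: "open W" "W \<noteq> {}"
      "\<And>k x. (f ^^ k) x \<in> W \<Longrightarrow> iter F (1 + c) k x \<in> V j"
      using collective_shrink[OF comp assms(5) UVj(3,4)] by (metis order_refl)
    \<comment> \<open>Feeble openness makes this a nonempty open source set for \<open>f\<close>,
      and each of its points is the time-\<open>c\<close> position of some point of
      \<open>U j\<close>.\<close>
    let ?A = "interior (iter F 1 c ` U j)"
    have "thickly_syndetic ((+) c ` hitting_times ((^^) f) ?A W)"
      using interior_iter_image[OF assms(2) _ UVj(1,2)] W(1,2)
      by (intro thickly_syndetic_translate thick) auto
    then have "thickly_syndetic {l. j * l \<in> (+) c ` hitting_times ((^^) f) ?A W}"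
      using that by (intro thickly_syndetic_vimage_mult) auto
    moreover have "(+) c ` hitting_times ((^^) f) ?A W \<subseteq> hitting_times (iter F 1) (U j) (V j)"
    proof clarify
      fix k assume "k \<in> hitting_times ((^^) f) ?A W"
      then obtain y where y: "y \<in> ?A" "(f ^^ k) y \<in> W" unfolding hitting_times_iff by blast
      then obtain x where "x \<in> U j" "y = iter F 1 c x" using interior_subset by blast
      with y W(3) show "c + k \<in> hitting_times (iter F 1) (U j) (V j)"
        unfolding hitting_times_iff iter_add by auto
    qed
    ultimately show ?thesis by (elim thickly_syndetic_mono) blast
  qed
  then have "thickly_syndetic (\<Inter>j\<in>{1..m}. {l. j * l \<in> hitting_times (iter F 1) (U j) (V j)})"
    (is "thickly_syndetic ?S") by (intro thickly_syndetic_INT) auto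
  then obtain M where "\<And>i. \<exists>p\<in>{i..i+M}. {p..p+0} \<subseteq> ?S"
    unfolding thickly_syndetic_def by blast
  \<comment> \<open>Searching from 1 onwards excludes \<open>l = 0\<close>, which
    \<open>hitting_times\<close> alone would allow.\<close>
  from this[of 1] obtain p where "p \<ge> 1" "p \<in> ?S" by auto
  then show "\<exists>l\<ge>1. \<forall>j\<in>{1..m}. iter F 1 (j * l) ` U j \<inter> V j \<noteq> {}"
    unfolding hitting_times_def by blast
qed

end
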